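(* Every infinite totally disconnected $\omega$-bounded group contains an unconditionally $f_\omega$-productive sequence.
   Context: All topological groups are Hausdorff; $\mathbb N=\{0,1,2,\dots\}$. A topological group $G$ is $\omega$-bounded if the closure of every countable subset of $G$ is compact. Products are ordered: $\prod_{n=0}^m b_n=b_0b_1\cdots b_m$. A sequence $\{b_n:n\in\mathbb N\}$ in a topological group $G$ is productive if $\{\prod_{n=0}^m b_n:m\in\mathbb N\}$ converges to some element of $G$. A sequence $\{a_n:n\in\mathbb N\}$ in $G$ is $f_\omega$-productive if it is faithfully indexed ($a_n\ne a_m$ for $n\neq m$) and $\{a_n^{z(n)}:n\in\mathbb N\}$ is productive for every function $z:\mathbb N\to\mathbb Z$. ($f_\omega$ is the constant function with value $\omega$.) It is unconditionally $f_\omega$-productive if it is faithfully indexed and $\{a_{\varphi(n)}:n\in\mathbb N\}$ is $f_\omega$-productive for every bijection $\varphi:\mathbb N\to\mathbb N$. *)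

theory Defs
  imports "HOL-Analysis.Analysis" "HOL-Algebra.Group"
begin

(* All topological groups are Hausdorff, as in the source. *)
locale topological_group = group G for G (structure) +
  fixes T :: "'a topology"
  assumes topspace_eq_carrier: "topspace T = carrier G"
    and Hausdorff: "Hausdorff_space T"
    and continuous_mult: "continuous_map (prod_topology T T) T (\<lambda>(x, y). x \<otimes> y)"
    and continuous_inv: "continuous_map T T (\<lambda>x. inv x)"

definition totally_disconnected_space :: "'a topology \<Rightarrow> bool" where
  "totally_disconnected_space T \<longleftrightarrow>
     (\<forall>x \<in> topspace T. connected_component_of_set T x = {x})"

definition omega_bounded :: "'a topology \<Rightarrow> bool" where
  "omega_bounded T \<longleftrightarrow>
     (\<forall>S. S \<subseteq> topspace T \<and> countable S \<longrightarrow> compactin T (T closure_of S))"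

(* b 0 \<otimes> b 1 \<otimes> ... \<otimes> b m, with m + 1 factors *)
primrec ordered_prod :: "('a, 'b) monoid_scheme \<Rightarrow> (nat \<Rightarrow> 'a) \<Rightarrow> nat \<Rightarrow> 'a" where
  "ordered_prod G b 0 = b 0"
| "ordered_prod G b (Suc m) = ordered_prod G b m \<otimes>\<^bsub>G\<^esub> b (Suc m)"

definition productive ::
    "('a, 'b) monoid_scheme \<Rightarrow> 'a topology \<Rightarrow> (nat \<Rightarrow> 'a) \<Rightarrow> bool" where
  "productive G T b \<longleftrightarrow>
     range b \<subseteq> carrier G \<and> (\<exists>l \<in> carrier G. limitin T (ordered_prod G b) l sequentially)"

definition f_omega_productive ::
    "('a, 'b) monoid_scheme \<Rightarrow> 'a topology \<Rightarrow> (nat \<Rightarrow> 'a) \<Rightarrow> bool" where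
  "f_omega_productive G T a \<longleftrightarrow>
     range a \<subseteq> carrier G \<and> inj a \<and>
     (\<forall>z :: nat \<Rightarrow> int. productive G T (\<lambda>n. a n [^]\<^bsub>G\<^esub> z n))"

definition unconditionally_f_omega_productive ::
    "('a, 'b) monoid_scheme \<Rightarrow> 'a topology \<Rightarrow> (nat \<Rightarrow> 'a) \<Rightarrow> bool" where
  "unconditionally_f_omega_productive G T a \<longleftrightarrow>
     range a \<subseteq> carrier G \<and> inj a \<and>
     (\<forall>\<phi> :: nat \<Rightarrow> nat. bij \<phi> \<longrightarrow> f_omega_productive G T (\<lambda>n. a (\<phi> n)))"

end

theory Submission
  imports Defs "HOL-Algebra.Generated_Groups"
begin

text \<open>The closure of a countable infinite subgroup is an infinite profinite group \<open>K\<close>. Any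
  injective sequence converging to \<open>\<one>\<close> in \<open>K\<close> will do: almost all factors lie in a given
  open subgroup \<open>U\<close>, whatever the exponents and the order, so the partial products eventually
  stay in one left coset of \<open>U\<close>, and compactness yields a limit.

  Such a sequence exists although \<open>K\<close> need not be metrizable. Let \<open>L\<close> be the intersection of a
  strictly decreasing sequence of open subgroups \<open>U n\<close>, and let \<open>x n \<in> U n - U (n + 1)\<close>. The
  pairwise disjoint cosets \<open>x n L\<close> converge to \<open>L\<close>. By Zorn's lemma there is a minimal closed
  subgroup \<open>M \<subseteq> L\<close> with a sequence of cosets of \<open>M\<close> inside these that converges to \<open>M\<close>;
  such a sequence can be refined by any open subgroup, so \<open>M\<close> is trivial and the cosets
  are single points.\<close>

section \<open>Directed intersections in compact spaces; countable subgroups\<close>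

text \<open>The complement of \<open>V\<close> is compact and misses the whole intersection, so it
  misses the intersection of finitely many members; directedness gives one member below
  these.\<close>

lemma compact_space_directed_Inter_subset:
  assumes "compact_space X" "\<C> \<noteq> {}" and clo: "\<And>C. C \<in> \<C> \<Longrightarrow> closedin X C"
    and dir: "\<And>C D. C \<in> \<C> \<Longrightarrow> D \<in> \<C> \<Longrightarrow> \<exists>E\<in>\<C>. E \<subseteq> C \<inter> D"
    and V: "openin X V" "\<Inter>\<C> \<subseteq> V"
  shows "\<exists>C\<in>\<C>. C \<subseteq> V"
proof -
  have lower: "\<exists>E\<in>\<C>. E \<subseteq> \<Inter>\<F>" if "finite \<F>" "\<F> \<subseteq> \<C>" for \<F>
    using that
  proof (induction rule: finite_induct)
    case empty
    then show ?case using \<open>\<C> \<noteq> {}\<close> by auto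
  next
    case (insert C \<F>)
    then obtain D where "D \<in> \<C>" "D \<subseteq> \<Inter>\<F>" by auto
    moreover have "C \<in> \<C>" using insert.prems by blast
    ultimately obtain E where "E \<in> \<C>" "E \<subseteq> C \<inter> D" using dir by blast
    then show ?case using \<open>D \<subseteq> \<Inter>\<F>\<close> by (intro bexI[of _ E]) auto
  qed
  have "compactin X (topspace X - V)"
    using assms(1) V(1) by (intro closedin_compact_space) auto
  moreover have "(topspace X - V) \<inter> \<Inter>\<C> = {}" using V by auto
  ultimately obtain \<F> where "finite \<F>" "\<F> \<subseteq> \<C>" "(topspace X - V) \<inter> \<Inter>\<F> = {}"
    unfolding compactin_fip using clo by blast
  moreover then obtain E where E: "E \<in> \<C>" "E \<subseteq> \<Inter>\<F>" using lower by blast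
  moreover have "E \<subseteq> topspace X" using clo E closedin_subset by blast
  ultimately show ?thesis by blast
qed

lemma totally_disconnected_space_subtopology:
  assumes "totally_disconnected_space X"
  shows "totally_disconnected_space (subtopology X S)"
  unfolding totally_disconnected_space_def
proof (intro ballI subset_antisym subsetI)
  fix x y assume x: "x \<in> topspace (subtopology X S)"
    and y: "y \<in> connected_component_of_set (subtopology X S) x"
  then have "connected_component_of X x y"
    by (auto simp: connected_component_of_def connectedin_subtopology)
  then show "y \<in> {x}"
    using assms x unfolding totally_disconnected_space_def by fastforce
qed (auto simp: connected_component_of_refl)

text \<open>Finite words in the elements of \<open>S\<close> and their inverses form such a
  subgroup, and a countable alphabet has only countably many words.\<close>

lemma (in group) countable_subgroup_superset:
  assumes S: "countable S" "S \<subseteq> carrier G"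
  shows "\<exists>H. subgroup H G \<and> S \<subseteq> H \<and> countable H"
proof -
  define A where "A = S \<union> m_inv G ` S"
  define p where "p = (\<lambda>xs. foldr (\<otimes>) xs \<one>)"
  have A: "countable A" "A \<subseteq> carrier G" "m_inv G ` A \<subseteq> A"
    using S by (auto simp: A_def)
  have p_closed: "p xs \<in> carrier G" if "xs \<in> lists A" for xs
    using that A(2) by (induction xs) (auto simp: p_def)
  have p_append: "p (xs @ ys) = p xs \<otimes> p ys" if "xs \<in> lists A" "ys \<in> lists A" for xs ys
    using that
  proof (induction xs)
    case Nil
    then show ?case using p_closed by (auto simp: p_def)
  next
    case (Cons x xs)
    then show ?case using A(2) p_closed by (simp add: p_def) (metis m_assoc subsetD)
  qed
  have p_inv: "\<exists>ys\<in>lists A. inv (p xs) = p ys" if "xs \<in> lists A" for xs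
    using that
  proof (induction xs)
    case Nil
    then show ?case by (intro bexI[of _ "[]"]) (auto simp: p_def)
  next
    case (Cons x xs)
    then obtain ys where ys: "ys \<in> lists A" "inv (p xs) = p ys" by auto
    have x: "x \<in> carrier G" "inv x \<in> A" using Cons A by auto
    have "inv (p (x # xs)) = inv (p xs) \<otimes> inv x"
      using x Cons p_closed by (simp add: p_def inv_mult_group)
    also have "\<dots> = p (ys @ [inv x])"
      using ys x p_append[of ys "[inv x]"] by (simp add: p_def)
    finally show ?case using ys x by (intro bexI[of _ "ys @ [inv x]"]) auto
  qed
  have "subgroup (p ` lists A) G"
  proof
    show "\<one> \<in> p ` lists A" by (intro image_eqI[of _ _ "[]"]) (auto simp: p_def)
    show "x \<otimes> y \<in> p ` lists A" if xy: "x \<in> p ` lists A" "y \<in> p ` lists A" for x y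
    proof -
      obtain xs ys where "xs \<in> lists A" "ys \<in> lists A" "x = p xs" "y = p ys"
        using xy by blast
      then show ?thesis using p_append[of xs ys] by (intro image_eqI[of _ _ "xs @ ys"]) auto
    qed
    show "inv x \<in> p ` lists A" if "x \<in> p ` lists A" for x
      using that p_inv by blast
  qed (use p_closed in auto)
  moreover have "S \<subseteq> p ` lists A"
  proof
    fix x assume "x \<in> S"
    then show "x \<in> p ` lists A" using S by (intro image_eqI[of _ _ "[x]"]) (auto simp: p_def A_def)
  qed
  moreover have "countable (p ` lists A)" using A by simp
  ultimately show ?thesis by blast
qed

section \<open>Topological groups: translations, closures and subgroups\<close>

context topological_group
begin

lemma continuous_map_group_mult:
  assumes "continuous_map X T f" "continuous_map X T g"
  shows "continuous_map X T (\<lambda>x. f x \<otimes> g x)"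
  using continuous_map_compose[OF continuous_map_pairedI[OF assms] continuous_mult]
  by (simp add: o_def)

lemma continuous_map_left_translation:
  assumes "a \<in> carrier G"
  shows "continuous_map T T (\<lambda>x. a \<otimes> x)"
  using assms topspace_eq_carrier by (intro continuous_map_group_mult) auto

lemma openin_left_translation:
  assumes "a \<in> carrier G" "openin T U"
  shows "openin T {y \<in> carrier G. a \<otimes> y \<in> U}"
  using openin_continuous_map_preimage[OF continuous_map_left_translation] assms topspace_eq_carrier
  by metis

lemma closedin_left_translation:
  assumes "a \<in> carrier G" "closedin T C"
  shows "closedin T {y \<in> carrier G. a \<otimes> y \<in> C}"
  using closedin_continuous_map_preimage[OF continuous_map_left_translation] assms topspace_eq_carrier
  by metis

text \<open>A continuous map sends the closure of a set into the closure of its image, and the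
  closure of \<open>H \<times> H\<close> is the square of the closure of \<open>H\<close>.\<close>

lemma subgroup_closure_of:
  assumes H: "subgroup H G"
  shows "subgroup (T closure_of H) G"
proof
  have HG: "H \<subseteq> topspace T" using H subgroup.subset topspace_eq_carrier by blast
  show "T closure_of H \<subseteq> carrier G"
    using closure_of_subset_topspace topspace_eq_carrier by metis
  show "\<one> \<in> T closure_of H"
    using closure_of_subset[OF HG] subgroup.one_closed[OF H] by blast
  show "inv x \<in> T closure_of H" if "x \<in> T closure_of H" for x
  proof -
    have "inv x \<in> T closure_of (m_inv G ` H)"
      using continuous_map_image_closure_subset[OF continuous_inv] that by blast
    moreover have "m_inv G ` H \<subseteq> H" using subgroup.m_inv_closed[OF H] by blast
    ultimately show ?thesis using closure_of_mono by blast
  qed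
  show "x \<otimes> y \<in> T closure_of H" if "x \<in> T closure_of H" "y \<in> T closure_of H" for x y
  proof -
    have "(\<lambda>(x, y). x \<otimes> y) (x, y) \<in> T closure_of ((\<lambda>(x, y). x \<otimes> y) ` (H \<times> H))"
      using continuous_map_image_closure_subset[OF continuous_mult, of "H \<times> H"] that
      unfolding closure_of_Times by blast
    moreover have "(\<lambda>(x, y). x \<otimes> y) ` (H \<times> H) \<subseteq> H" using subgroup.m_closed[OF H] by auto
    ultimately show ?thesis using closure_of_mono[of "(\<lambda>(x, y). x \<otimes> y) ` (H \<times> H)" H T] by auto
  qed
qed

text \<open>The complement is the union of the left cosets \<open>x U\<close> with \<open>x\<close>
  outside \<open>U\<close>, each open as a preimage under a translation.\<close>

lemma closedin_open_subgroup:
  assumes U: "subgroup U G" "openin T U"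
  shows "closedin T U"
proof -
  have UG: "U \<subseteq> carrier G" using U subgroup.subset by blast
  have "carrier G - U = (\<Union>x\<in>carrier G - U. {y \<in> carrier G. inv x \<otimes> y \<in> U})"
  proof (intro subset_antisym subsetI)
    fix y assume "y \<in> (\<Union>x\<in>carrier G - U. {y \<in> carrier G. inv x \<otimes> y \<in> U})"
    then obtain x where x: "x \<in> carrier G" "x \<notin> U" "y \<in> carrier G" "inv x \<otimes> y \<in> U" by auto
    have "x = y \<otimes> inv (inv x \<otimes> y)" using x by (simp add: inv_mult_group m_assoc[symmetric])
    then have "y \<notin> U" using x subgroup.m_closed[OF U(1)] subgroup.m_inv_closed[OF U(1)] by metis
    then show "y \<in> carrier G - U" using x by auto
  next
    fix y assume "y \<in> carrier G - U"
    then show "y \<in> (\<Union>x\<in>carrier G - U. {y \<in> carrier G. inv x \<otimes> y \<in> U})"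
      using subgroup.one_closed[OF U(1)] by (intro UN_I[of y]) auto
  qed
  moreover have "openin T (\<Union>x\<in>carrier G - U. {y \<in> carrier G. inv x \<otimes> y \<in> U})"
    using U by (intro openin_Union) (auto intro!: openin_left_translation)
  ultimately show ?thesis using UG by (simp add: closedin_def topspace_eq_carrier)
qed

lemma topological_group_subgroup:
  assumes K: "subgroup K G"
  shows "topological_group (G\<lparr>carrier := K\<rparr>) (subtopology T K)"
proof -
  interpret K: group "G\<lparr>carrier := K\<rparr>" using K subgroup_imp_group by blast
  have KG: "K \<subseteq> carrier G" using K subgroup.subset by blast
  show ?thesis
  proof
    show "topspace (subtopology T K) = carrier (G\<lparr>carrier := K\<rparr>)"
      using KG topspace_eq_carrier by auto
    show "Hausdorff_space (subtopology T K)" using Hausdorff Hausdorff_space_subtopology by blast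
    have "continuous_map (subtopology (prod_topology T T) (K \<times> K)) T (\<lambda>(x, y). x \<otimes> y)"
      using continuous_mult continuous_map_from_subtopology by blast
    then have "continuous_map (prod_topology (subtopology T K) (subtopology T K)) (subtopology T K) (\<lambda>(x, y). x \<otimes> y)"
      using subgroup.m_closed[OF K]
      by (auto simp: continuous_map_in_subtopology subtopology_Times)
    then show "continuous_map (prod_topology (subtopology T K) (subtopology T K)) (subtopology T K)
      (\<lambda>(x, y). x \<otimes>\<^bsub>G\<lparr>carrier := K\<rparr>\<^esub> y)" by simp
    have "continuous_map (subtopology T K) (subtopology T K) (\<lambda>x. inv x)"
      using subgroup.m_inv_closed[OF K] continuous_map_from_subtopology[OF continuous_inv]
      by (auto simp: continuous_map_in_subtopology)
    then show "continuous_map (subtopology T K) (subtopology T K) (\<lambda>x. inv\<^bsub>G\<lparr>carrier := K\<rparr>\<^esub> x)"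
      by (rule continuous_map_eq) (use m_inv_consistent[OF K] in auto)
  qed
qed

text \<open>Partial products and integer powers of a sequence in \<open>K\<close> are the same in
  \<open>K\<close> and in \<open>G\<close>, and a limit in \<open>K\<close> is a limit in
  \<open>G\<close>.\<close>

lemma unconditionally_f_omega_productive_of_subgroup:
  assumes K: "subgroup K G"
    and a: "unconditionally_f_omega_productive (G\<lparr>carrier := K\<rparr>) (subtopology T K) a"
  shows "unconditionally_f_omega_productive G T a"
proof -
  have KG: "K \<subseteq> carrier G" using K subgroup.subset by blast
  have op: "ordered_prod (G\<lparr>carrier := K\<rparr>) b = ordered_prod G b" for b
  proof
    show "ordered_prod (G\<lparr>carrier := K\<rparr>) b m = ordered_prod G b m" for m by (induction m) auto
  qed
  have prod: "productive G T b" if "productive (G\<lparr>carrier := K\<rparr>) (subtopology T K) b" for b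
    using that KG by (auto simp: productive_def op limitin_subtopology)
  have pow: "(\<lambda>n. b n [^]\<^bsub>G\<lparr>carrier := K\<rparr>\<^esub> z n) = (\<lambda>n. b n [^] z n)" if "range b \<subseteq> K"
    for b and z :: "nat \<Rightarrow> int"
  proof
    show "b n [^]\<^bsub>G\<lparr>carrier := K\<rparr>\<^esub> z n = b n [^] z n" for n
      using that by (intro int_pow_consistent[OF K, symmetric]) auto
  qed
  have f_omega: "f_omega_productive G T b"
    if "f_omega_productive (G\<lparr>carrier := K\<rparr>) (subtopology T K) b" for b
    unfolding f_omega_productive_def
  proof (intro conjI allI)
    have b: "range b \<subseteq> K" using that by (simp add: f_omega_productive_def)
    then show "range b \<subseteq> carrier G" using KG by blast
    show "inj b" using that by (simp add: f_omega_productive_def)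
    show "productive G T (\<lambda>n. b n [^] z n)" for z :: "nat \<Rightarrow> int"
    proof (rule prod)
      show "productive (G\<lparr>carrier := K\<rparr>) (subtopology T K) (\<lambda>n. b n [^] z n)"
        using that unfolding f_omega_productive_def pow[OF b, symmetric] by blast
    qed
  qed
  then show ?thesis
    unfolding unconditionally_f_omega_productive_def
  proof (intro conjI allI impI)
    show "range a \<subseteq> carrier G" "inj a"
      using a KG unfolding unconditionally_f_omega_productive_def by auto
    show "f_omega_productive G T (\<lambda>n. a (\<phi> n))" if "bij \<phi>" for \<phi>
      using a that f_omega unfolding unconditionally_f_omega_productive_def by simp
  qed
qed

end

section \<open>Open subgroups of profinite groups\<close>

lemma (in group) mult_inv_middle_cancel:
  assumes "x \<in> carrier G" "y \<in> carrier G" "z \<in> carrier G"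
  shows "(x \<otimes> y) \<otimes> (inv y \<otimes> z) = x \<otimes> z"
proof -
  have "(x \<otimes> y) \<otimes> (inv y \<otimes> z) = x \<otimes> ((y \<otimes> inv y) \<otimes> z)"
    using assms by (simp only: m_assoc m_closed inv_closed)
  then show ?thesis using assms by simp
qed

text \<open>The elements \<open>g\<close> with \<open>C g \<subseteq> C\<close> form a submonoid
  \<open>A\<close>, open by compactness. Those with \<open>inv g\<close> in \<open>A\<close> as well
  form a subgroup, which lies in \<open>C\<close> because \<open>\<one> \<in> C\<close>.\<close>

lemma (in topological_group) clopen_nhd_contains_open_subgroup:
  assumes "compact_space T" and C: "openin T C" "closedin T C" "\<one> \<in> C"
  shows "\<exists>U. subgroup U G \<and> openin T U \<and> U \<subseteq> C"
proof -
  have CG: "C \<subseteq> carrier G" using openin_subset[OF C(1)] topspace_eq_carrier by simp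
  define A where "A = {g \<in> carrier G. \<forall>c\<in>C. c \<otimes> g \<in> C}"
  define U where "U = {g \<in> carrier G. g \<in> A \<and> inv g \<in> A}"
  \<comment> \<open>\<open>D\<close> consists of the pairs \<open>(c, g)\<close> with
    \<open>c \<in> C\<close> and \<open>c \<otimes> g \<notin> C\<close>. It is closed, its second
    projection is the complement of \<open>A\<close>, and projection along a compact factor is a
    closed map.\<close>
  define D where "D = {p \<in> topspace (prod_topology T T). fst p \<in> C} \<inter>
    {p \<in> topspace (prod_topology T T). (\<lambda>(x, y). x \<otimes> y) p \<in> carrier G - C}"
  have "closedin T (carrier G - C)"
    using C(1) by (simp add: closedin_def topspace_eq_carrier Diff_Diff_Int Int_absorb1 CG)
  then have "closedin (prod_topology T T) D"
    unfolding D_def using C(2)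
    by (intro closedin_Int closedin_continuous_map_preimage[OF continuous_map_fst]
        closedin_continuous_map_preimage[OF continuous_mult]) auto
  then have "closedin T (snd ` D)"
    using closed_map_snd[OF \<open>compact_space T\<close>, of T] unfolding closed_map_def by blast
  moreover have "A = carrier G - snd ` D"
  proof (intro subset_antisym subsetI)
    fix g assume "g \<in> A"
    then show "g \<in> carrier G - snd ` D" by (auto simp: A_def D_def)
  next
    fix g assume g: "g \<in> carrier G - snd ` D"
    have "c \<otimes> g \<in> C" if "c \<in> C" for c
    proof (rule ccontr)
      assume "c \<otimes> g \<notin> C"
      then have "(c, g) \<in> D" using that CG g by (auto simp: D_def topspace_eq_carrier)
      then show False using g by force
    qed
    then show "g \<in> A" using g by (simp add: A_def)
  qed
  ultimately have A: "openin T A" by (metis topspace_eq_carrier openin_diff openin_topspace)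
  have "U = A \<inter> {g \<in> topspace T. inv g \<in> A}"
    by (auto simp: U_def A_def topspace_eq_carrier)
  then have "openin T U"
    using A openin_continuous_map_preimage[OF continuous_inv A] by auto
  moreover have "subgroup U G"
  proof
    have mult: "g \<otimes> h \<in> A" if "g \<in> A" "h \<in> A" for g h
    proof -
      have "c \<otimes> (g \<otimes> h) \<in> C" if "c \<in> C" for c
        using that \<open>g \<in> A\<close> \<open>h \<in> A\<close> CG by (auto simp: A_def m_assoc[symmetric])
      then show ?thesis using that by (auto simp: A_def)
    qed
    show "g \<otimes> h \<in> U" if "g \<in> U" "h \<in> U" for g h
      using that by (auto simp: U_def inv_mult_group intro!: mult)
    show "U \<subseteq> carrier G" by (auto simp: U_def)
    show "\<one> \<in> U" using CG by (auto simp: U_def A_def)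
    show "inv g \<in> U" if "g \<in> U" for g using that by (auto simp: U_def)
  qed
  moreover have "U \<subseteq> C"
  proof
    fix g assume "g \<in> U"
    then have "g \<in> carrier G" "\<one> \<otimes> g \<in> C" using C(3) unfolding U_def A_def by blast+
    then show "g \<in> C" by simp
  qed
  ultimately show ?thesis by blast
qed

locale profinite_group = topological_group G T for G (structure) and T +
  assumes compact: "compact_space T"
    and totally_disconnected: "totally_disconnected_space T"
begin

text \<open>In a compact Hausdorff space components are quasi-components, so some clopen set
  contains \<open>\<one>\<close> but not \<open>x\<close>; an open subgroup lies inside it.\<close>

lemma open_subgroup_avoiding:
  assumes x: "x \<in> carrier G" "x \<noteq> \<one>"
  shows "\<exists>U. subgroup U G \<and> openin T U \<and> x \<notin> U"
proof -
  have "\<not> connected_component_of T \<one> x"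
    using totally_disconnected x topspace_eq_carrier
    unfolding totally_disconnected_space_def by blast
  then have "\<not> quasi_component_of T \<one> x"
    using compact Hausdorff quasi_eq_connected_component_of by metis
  then obtain C where "\<one> \<in> C" "closedin T C" "openin T C" "x \<notin> C"
    using x topspace_eq_carrier unfolding quasi_component_of by auto
  then show ?thesis using clopen_nhd_contains_open_subgroup[OF compact] by blast
qed

text \<open>Open subgroups are closed sets, are directed under intersection and have only
  \<open>\<one>\<close> in common, so compactness places one of them inside
  \<open>V\<close>.\<close>

lemma nhd_one_contains_open_subgroup:
  assumes V: "openin T V" "\<one> \<in> V"
  shows "\<exists>U. subgroup U G \<and> openin T U \<and> U \<subseteq> V"
proof -
  let ?\<C> = "{U. subgroup U G \<and> openin T U}"
  have top: "carrier G \<in> ?\<C>"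
    using subgroup_self openin_topspace[of T] by (simp add: topspace_eq_carrier)
  have "\<exists>U\<in>?\<C>. U \<subseteq> V"
  proof (rule compact_space_directed_Inter_subset[OF compact])
    show "?\<C> \<noteq> {}" using top by blast
    show "closedin T C" if "C \<in> ?\<C>" for C
      using that closedin_open_subgroup by blast
    show "\<exists>E\<in>?\<C>. E \<subseteq> C \<inter> D" if "C \<in> ?\<C>" "D \<in> ?\<C>" for C D
      using that subgroups_Inter_pair[of C D] openin_Int[of T C D] by (intro bexI[of _ "C \<inter> D"]) auto
    show "\<Inter>?\<C> \<subseteq> V"
    proof
      fix x assume x: "x \<in> \<Inter>?\<C>"
      then have "x \<in> carrier G" using top by blast
      then have "x = \<one>" using x open_subgroup_avoiding[of x] by blast
      then show "x \<in> V" using V by simp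
    qed
  qed (use V in auto)
  then show ?thesis by blast
qed

section \<open>Infinite products in profinite groups\<close>

text \<open>Assumption \<open>ev\<close> says that \<open>b\<close> converges to
  \<open>\<one>\<close>, open subgroups being a neighbourhood base there. A cluster point of the
  partial products is their limit: for each open subgroup it shares a closed left coset with almost
  all of them.\<close>

lemma productive_of_limitin_one:
  assumes b: "range b \<subseteq> carrier G"
    and ev: "\<And>U. subgroup U G \<Longrightarrow> openin T U \<Longrightarrow> \<forall>\<^sub>F n in sequentially. b n \<in> U"
  shows "productive G T b"
proof -
  define p where "p = ordered_prod G b"
  have bG: "b n \<in> carrier G" for n using b by blast
  have pG: "p n \<in> carrier G" for n using bG by (induction n) (auto simp: p_def)
  \<comment> \<open>Later partial products arise by multiplying on the right by factors in
    \<open>U\<close>, so they stay in the left coset \<open>p m U\<close>.\<close>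
  have cauchy: "\<exists>m. \<forall>n\<ge>m. inv (p m) \<otimes> p n \<in> U" if U: "subgroup U G" "openin T U" for U
  proof -
    obtain m where m: "\<And>n. n \<ge> m \<Longrightarrow> b n \<in> U"
      using ev[OF U] unfolding eventually_sequentially by blast
    have "inv (p m) \<otimes> p n \<in> U" if "n \<ge> m" for n
      using that
    proof (induction n rule: dec_induct)
      case base
      then show ?case using pG subgroup.one_closed[OF U(1)] by simp
    next
      case (step n)
      have "inv (p m) \<otimes> p (Suc n) = (inv (p m) \<otimes> p n) \<otimes> b (Suc n)"
        using pG[of m] pG[of n] bG[of "Suc n"] by (simp add: p_def m_assoc)
      then show ?case using step m[of "Suc n"] subgroup.m_closed[OF U(1)] by simp
    qed
    then show ?thesis by blast
  qed
  have pT: "p ` {k..} \<subseteq> topspace T" for k using pG topspace_eq_carrier by auto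
  \<comment> \<open>A point in the closure of every tail is a cluster point of the partial
    products.\<close>
  have "(\<Inter>k. T closure_of (p ` {k..})) \<noteq> {}"
  proof (rule compact_space_imp_nest[OF compact])
    show "T closure_of (p ` {k..}) \<noteq> {}" for k
      using closure_of_subset[OF pT] by blast
    show "decseq (\<lambda>k. T closure_of (p ` {k..}))"
      by (intro decseq_SucI closure_of_mono) auto
  qed auto
  then obtain l where "l \<in> (\<Inter>k. T closure_of (p ` {k..}))" unfolding ex_in_conv[symmetric] ..
  then have l: "l \<in> T closure_of (p ` {k..})" for k by (rule INT_D) simp
  have lG: "l \<in> carrier G" using l[of 0] closure_of_subset_topspace[of T] topspace_eq_carrier by auto
  have "limitin T p l sequentially"
    unfolding limitin_def
  proof (intro conjI allI impI)
    show "l \<in> topspace T" using lG topspace_eq_carrier by simp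
    fix V assume V: "openin T V \<and> l \<in> V"
    have "openin T {y \<in> carrier G. l \<otimes> y \<in> V}" using openin_left_translation lG V by blast
    then obtain U where U: "subgroup U G" "openin T U" "U \<subseteq> {y \<in> carrier G. l \<otimes> y \<in> V}"
      using nhd_one_contains_open_subgroup[of "{y \<in> carrier G. l \<otimes> y \<in> V}"] V lG by auto
    obtain m where m: "\<And>n. n \<ge> m \<Longrightarrow> inv (p m) \<otimes> p n \<in> U" using cauchy[OF U(1,2)] by blast
    \<comment> \<open>The coset \<open>p m U\<close> is closed and contains a tail, so it contains
      \<open>l\<close>.\<close>
    have "closedin T {y \<in> carrier G. inv (p m) \<otimes> y \<in> U}"
      using closedin_left_translation closedin_open_subgroup[OF U(1,2)] pG by blast
    then have "T closure_of (p ` {m..}) \<subseteq> {y \<in> carrier G. inv (p m) \<otimes> y \<in> U}"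
      using m pG by (intro closure_of_minimal) auto
    then have lU: "inv (p m) \<otimes> l \<in> U" using l by blast
    have "p n \<in> V" if "n \<ge> m" for n
    proof -
      \<comment> \<open>Both \<open>p n\<close> and \<open>l\<close> lie in \<open>p m U\<close>, so
        \<open>p n\<close> is in \<open>l U\<close>, which is inside \<open>V\<close> by the choice
        of \<open>U\<close>.\<close>
      have "inv (inv (p m) \<otimes> l) \<otimes> (inv (p m) \<otimes> p n) = inv l \<otimes> p n"
        using pG[of m] pG[of n] lG by (simp add: inv_mult_group mult_inv_middle_cancel)
      then have "inv l \<otimes> p n \<in> U"
        using subgroup.m_closed[OF U(1) subgroup.m_inv_closed[OF U(1) lU] m[OF that]] by simp
      then have "l \<otimes> (inv l \<otimes> p n) \<in> V" using U(3) by blast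
      then show ?thesis using pG[of n] lG by (simp add: m_assoc[symmetric])
    qed
    then show "\<forall>\<^sub>F n in sequentially. p n \<in> V" unfolding eventually_sequentially by blast
  qed
  then show ?thesis using b lG by (auto simp: productive_def p_def)
qed

text \<open>A bijection sends only finitely many indices below a given bound, so almost all
  reordered terms still lie in a given open subgroup, which absorbs every integer power.\<close>

lemma unconditionally_f_omega_productive_of_limitin_one:
  assumes a: "range a \<subseteq> carrier G" "inj a" and lim: "limitin T a \<one> sequentially"
  shows "unconditionally_f_omega_productive G T a"
proof -
  have aG: "a n \<in> carrier G" for n using a by blast
  have productive: "productive G T (\<lambda>n. a (\<phi> n) [^] z n)" if "bij \<phi>" for \<phi> :: "nat \<Rightarrow> nat" and z :: "nat \<Rightarrow> int"
  proof (rule productive_of_limitin_one)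
    fix U assume U: "subgroup U G" "openin T U"
    then have "\<forall>\<^sub>F n in sequentially. a n \<in> U"
      using lim subgroup.one_closed[OF U(1)] unfolding limitin_def by blast
    then obtain m where m: "\<And>n. n \<ge> m \<Longrightarrow> a n \<in> U" unfolding eventually_sequentially by blast
    have "finite (\<phi> -` {..<m})"
      using that by (intro finite_vimageI) (auto simp: bij_is_inj)
    then have "\<forall>\<^sub>F n in sequentially. n \<notin> \<phi> -` {..<m}"
      unfolding cofinite_eq_sequentially[symmetric] eventually_cofinite by (simp add: vimage_def)
    then show "\<forall>\<^sub>F n in sequentially. a (\<phi> n) [^] z n \<in> U"
    proof eventually_elim
      case (elim n)
      then have "a (\<phi> n) \<in> U" using m by simp
      then show ?case by (rule subgroup_int_pow_closed[OF U(1)])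
    qed
  qed (use aG in auto)
  have "f_omega_productive G T (\<lambda>n. a (\<phi> n))" if "bij \<phi>" for \<phi> :: "nat \<Rightarrow> nat"
    unfolding f_omega_productive_def
  proof (intro conjI allI)
    show "range (\<lambda>n. a (\<phi> n)) \<subseteq> carrier G" using aG by blast
    show "inj (\<lambda>n. a (\<phi> n))"
      using inj_compose[OF a(2) bij_is_inj[OF that]] by (simp add: o_def)
    show "productive G T (\<lambda>n. a (\<phi> n) [^] z n)" for z :: "nat \<Rightarrow> int"
      using productive[OF that] .
  qed
  then show ?thesis using a unfolding unconditionally_f_omega_productive_def by blast
qed

end

section \<open>Sequences of cosets converging to a subgroup\<close>

lemma (in group) subgroup_mult_left_iff:
  assumes U: "subgroup U G" and x: "x \<in> U" and y: "y \<in> carrier G"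
  shows "x \<otimes> y \<in> U \<longleftrightarrow> y \<in> U"
proof
  assume "x \<otimes> y \<in> U"
  then have "inv x \<otimes> (x \<otimes> y) \<in> U"
    using x subgroup.m_closed[OF U] subgroup.m_inv_closed[OF U] by blast
  then show "y \<in> U" using y subgroup.mem_carrier[OF U x] by (simp add: m_assoc[symmetric])
qed (use x subgroup.m_closed[OF U] in blast)

context topological_group
begin

text \<open>The set is the product \<open>U L\<close>, which contains \<open>L\<close> when
  \<open>\<one> \<in> U\<close>; in this form it is a union of preimages of
  \<open>U\<close>.\<close>

lemma openin_right_quotient:
  assumes "openin T U" "L \<subseteq> carrier G"
  shows "openin T {y \<in> carrier G. \<exists>l\<in>L. y \<otimes> inv l \<in> U}"
proof -
  have "openin T {y \<in> topspace T. y \<otimes> inv l \<in> U}" if "l \<in> L" for l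
    using that assms topspace_eq_carrier
    by (intro openin_continuous_map_preimage[OF continuous_map_group_mult]) auto
  then have "openin T (\<Union>l\<in>L. {y \<in> topspace T. y \<otimes> inv l \<in> U})" by blast
  moreover have "(\<Union>l\<in>L. {y \<in> topspace T. y \<otimes> inv l \<in> U}) = {y \<in> carrier G. \<exists>l\<in>L. y \<otimes> inv l \<in> U}"
    using topspace_eq_carrier by auto
  ultimately show ?thesis by simp
qed

text \<open>\<open>E 0\<close> is the subgroup; \<open>E 1\<close>, \<open>E 2\<close>, ... are left cosets of it that converge to it.\<close>

definition coset_sequence :: "(nat \<Rightarrow> 'a set) \<Rightarrow> bool" where
  "coset_sequence E \<longleftrightarrow> \<one> \<in> E 0 \<and> (\<forall>n. closedin T (E n) \<and> E n \<noteq> {}) \<and>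
    (\<forall>n. \<forall>x\<in>E n. \<forall>y\<in>carrier G. y \<in> E n \<longleftrightarrow> inv x \<otimes> y \<in> E 0) \<and>
    (\<forall>V. openin T V \<and> E 0 \<subseteq> V \<longrightarrow> (\<forall>\<^sub>F n in sequentially. E n \<subseteq> V))"

lemma coset_sequenceI:
  assumes "\<one> \<in> E 0" "\<And>n. closedin T (E n)" "\<And>n. E n \<noteq> {}"
    and "\<And>n x y. x \<in> E n \<Longrightarrow> y \<in> carrier G \<Longrightarrow> y \<in> E n \<longleftrightarrow> inv x \<otimes> y \<in> E 0"
    and "\<And>V. openin T V \<Longrightarrow> E 0 \<subseteq> V \<Longrightarrow> \<forall>\<^sub>F n in sequentially. E n \<subseteq> V"
  shows "coset_sequence E"
  unfolding coset_sequence_def using assms by simp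

lemma coset_sequence_subset_carrier: "coset_sequence E \<Longrightarrow> E n \<subseteq> carrier G"
  unfolding coset_sequence_def using closedin_subset topspace_eq_carrier by metis

lemma coset_sequence_one: "coset_sequence E \<Longrightarrow> \<one> \<in> E 0"
  and coset_sequence_closedin: "coset_sequence E \<Longrightarrow> closedin T (E n)"
  and coset_sequence_nonempty: "coset_sequence E \<Longrightarrow> E n \<noteq> {}"
  unfolding coset_sequence_def by simp_all

lemma coset_sequence_iff:
  "coset_sequence E \<Longrightarrow> x \<in> E n \<Longrightarrow> y \<in> carrier G \<Longrightarrow> y \<in> E n \<longleftrightarrow> inv x \<otimes> y \<in> E 0"
  unfolding coset_sequence_def by blast

lemma coset_sequence_eventually:
  "coset_sequence E \<Longrightarrow> openin T V \<Longrightarrow> E 0 \<subseteq> V \<Longrightarrow> \<forall>\<^sub>F n in sequentially. E n \<subseteq> V"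
  unfolding coset_sequence_def by blast

text \<open>For large \<open>n\<close>, \<open>E n\<close> lies in the open neighbourhood
  \<open>U E 0\<close> of \<open>E 0\<close>. If \<open>y = u \<otimes> l\<close> is in
  \<open>E n\<close> with \<open>u \<in> U\<close> and \<open>l \<in> E 0\<close>, then
  \<open>u = y \<otimes> inv l\<close> is in \<open>y E 0\<close>, which is
  \<open>E n\<close>.\<close>

lemma coset_sequence_eventually_meets:
  assumes E: "coset_sequence E" and U: "subgroup U G" "openin T U"
  shows "\<forall>\<^sub>F n in sequentially. E n \<inter> U \<noteq> {}"
proof -
  let ?V = "{y \<in> carrier G. \<exists>l\<in>E 0. y \<otimes> inv l \<in> U}"
  have EG: "E n \<subseteq> carrier G" for n using coset_sequence_subset_carrier[OF E] .
  have "y \<in> ?V" if "y \<in> E 0" for y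
    using that EG[of 0] subgroup.one_closed[OF U(1)] by (auto intro!: bexI[of _ y])
  then have "\<forall>\<^sub>F n in sequentially. E n \<subseteq> ?V"
    using coset_sequence_eventually[OF E openin_right_quotient[OF U(2) EG]] by blast
  then show ?thesis
  proof eventually_elim
    case (elim n)
    obtain y where y: "y \<in> E n" using coset_sequence_nonempty[OF E] by blast
    then obtain l where l: "l \<in> E 0" "y \<otimes> inv l \<in> U" using elim by blast
    have G: "y \<in> carrier G" "l \<in> carrier G" using y l EG by blast+
    \<comment> \<open>The coset condition at index 0, taken at \<open>l\<close> and
      \<open>\<one>\<close>, gives closure under inverses.\<close>
    have "inv l \<in> E 0"
      using coset_sequence_iff[OF E l(1), of \<one>] coset_sequence_one[OF E] G by simp
    then have "inv y \<otimes> (y \<otimes> inv l) \<in> E 0" using G by (simp add: m_assoc[symmetric])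
    then have "y \<otimes> inv l \<in> E n" using coset_sequence_iff[OF E y] G by simp
    then show ?case using l by blast
  qed
qed

text \<open>Replacing \<open>E 0\<close> by \<open>E 0 \<inter> U\<close> keeps convergence because \<open>U\<close> is clopen: if
  \<open>E 0 \<inter> U \<subseteq> V\<close>, then \<open>E 0 \<subseteq> V \<union> (G - U)\<close>. The remaining cosets shrink to
  \<open>E n \<inter> s n U\<close>, where \<open>s n \<in> E n\<close> lies in \<open>U\<close> for almost all \<open>n\<close>.\<close>

lemma coset_sequence_refine:
  assumes E: "coset_sequence E" and U: "subgroup U G" "openin T U"
  shows "\<exists>F. coset_sequence F \<and> F \<le> E \<and> F 0 = E 0 \<inter> U"
proof -
  have EG: "E n \<subseteq> carrier G" for n using coset_sequence_subset_carrier[OF E] .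
  \<comment> \<open>If \<open>E n\<close> misses \<open>U\<close>, any point of \<open>E n\<close>
    is taken, so that \<open>F n\<close> below is nonempty for every \<open>n\<close>.\<close>
  have "\<exists>x. x \<in> E n \<and> (E n \<inter> U \<noteq> {} \<longrightarrow> x \<in> U)" for n
    using coset_sequence_nonempty[OF E, of n] by (cases "E n \<inter> U = {}") auto
  then obtain s where s: "\<And>n. s n \<in> E n" "\<And>n. E n \<inter> U \<noteq> {} \<Longrightarrow> s n \<in> U" by metis
  have sG: "s n \<in> carrier G" for n using s EG by blast
  define F where "F = (\<lambda>n. {y \<in> E n. inv (s n) \<otimes> y \<in> U})"
  have F_eq: "F n = E n \<inter> U" if "s n \<in> U" for n
    using that subgroup_mult_left_iff[OF U(1) subgroup.m_inv_closed[OF U(1) that]] EG[of n] by (auto simp: F_def)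
  have one: "\<one> \<in> E 0 \<inter> U" using coset_sequence_one[OF E] subgroup.one_closed[OF U(1)] by blast
  then have F0: "F 0 = E 0 \<inter> U" using F_eq s(2)[of 0] by blast
  have "coset_sequence F"
  proof (rule coset_sequenceI)
    show "\<one> \<in> F 0" using one F0 by blast
    show "closedin T (F n)" for n
    proof -
      have "F n = E n \<inter> {y \<in> carrier G. inv (s n) \<otimes> y \<in> U}" using EG by (auto simp: F_def)
      then show ?thesis
        using closedin_left_translation[OF _ closedin_open_subgroup[OF U], of "inv (s n)"] sG
          coset_sequence_closedin[OF E, of n] by auto
    qed
    show "F n \<noteq> {}" for n
      using s(1)[of n] sG[of n] subgroup.one_closed[OF U(1)] by (auto simp: F_def intro!: exI[of _ "s n"])
    show "y \<in> F n \<longleftrightarrow> inv x \<otimes> y \<in> F 0" if "x \<in> F n" "y \<in> carrier G" for n x y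
    proof -
      have x: "x \<in> E n" "inv (s n) \<otimes> x \<in> U" using that by (auto simp: F_def)
      then have xG: "x \<in> carrier G" using EG by blast
      \<comment> \<open>Since \<open>inv (s n) \<otimes> x\<close> is in \<open>U\<close>,
        \<open>x\<close> may replace \<open>s n\<close> as representative of the coset of
        \<open>U\<close>.\<close>
      have "inv (s n) \<otimes> y = (inv (s n) \<otimes> x) \<otimes> (inv x \<otimes> y)"
        using sG xG that by (simp add: mult_inv_middle_cancel)
      then have "inv (s n) \<otimes> y \<in> U \<longleftrightarrow> inv x \<otimes> y \<in> U" using subgroup_mult_left_iff[OF U(1) x(2)] xG that by simp
      then show ?thesis
        using coset_sequence_iff[OF E x(1)] that unfolding F0 by (auto simp: F_def)
    qed
    show "\<forall>\<^sub>F n in sequentially. F n \<subseteq> V" if V: "openin T V" "F 0 \<subseteq> V" for V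
    proof -
      have "openin T (V \<union> (topspace T - U))"
        using V closedin_open_subgroup[OF U] by (intro openin_Un openin_diff) auto
      moreover have "E 0 \<subseteq> V \<union> (topspace T - U)"
        using V EG[of 0] unfolding F0 topspace_eq_carrier by blast
      ultimately have "\<forall>\<^sub>F n in sequentially. E n \<subseteq> V \<union> (topspace T - U)"
        using coset_sequence_eventually[OF E] by blast
      then show ?thesis
        using coset_sequence_eventually_meets[OF E U]
      proof eventually_elim
        case (elim n)
        then show ?case using F_eq[OF s(2)] by blast
      qed
    qed
  qed
  moreover have "F \<le> E" by (auto simp: F_def le_fun_def)
  ultimately show ?thesis using F0 by blast
qed

text \<open>By compactness (\<open>small\<close>), an open set containing the intersection at index
  \<open>n\<close> already contains \<open>E n\<close> for a single \<open>E\<close> of the chain.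
  At index 0 this reduces convergence to that of one \<open>E\<close>.\<close>

lemma coset_sequence_INT_chain:
  assumes "compact_space T" "C \<noteq> {}" and cs: "\<And>E. E \<in> C \<Longrightarrow> coset_sequence E"
    and chain: "\<And>E F. E \<in> C \<Longrightarrow> F \<in> C \<Longrightarrow> E \<le> F \<or> F \<le> E"
  shows "coset_sequence (\<lambda>n. \<Inter>E\<in>C. E n)"
proof -
  have E: "closedin T (E n)" "E n \<noteq> {}" "\<one> \<in> E 0" if "E \<in> C" for E n
    using coset_sequence_closedin coset_sequence_nonempty coset_sequence_one cs[OF that] by blast+
  have small: "\<exists>E\<in>C. E n \<subseteq> V" if V: "openin T V" "(\<Inter>E\<in>C. E n) \<subseteq> V" for n V
  proof -
    have "\<exists>D\<in>(\<lambda>E. E n) ` C. D \<subseteq> V"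
    proof (rule compact_space_directed_Inter_subset[OF \<open>compact_space T\<close>])
      show "\<exists>A\<in>(\<lambda>E. E n) ` C. A \<subseteq> A1 \<inter> A2"
        if "A1 \<in> (\<lambda>E. E n) ` C" "A2 \<in> (\<lambda>E. E n) ` C" for A1 A2
      proof -
        obtain E F where EF: "E \<in> C" "F \<in> C" "A1 = E n" "A2 = F n" using \<open>A1 \<in> _\<close> \<open>A2 \<in> _\<close> by blast
        then consider "E n \<subseteq> F n" | "F n \<subseteq> E n" using chain[of E F] by (auto simp: le_fun_def)
        then show ?thesis using EF by cases blast+
      qed
    qed (use V E \<open>C \<noteq> {}\<close> in auto)
    then show ?thesis by blast
  qed
  show ?thesis
  proof (rule coset_sequenceI)
    show "\<one> \<in> (\<Inter>E\<in>C. E 0)" using E(3) by blast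
    show "closedin T (\<Inter>E\<in>C. E n)" for n using E \<open>C \<noteq> {}\<close> by auto
    \<comment> \<open>With the empty set for \<open>V\<close>, \<open>small\<close> would yield an
      empty \<open>E n\<close>.\<close>
    show "(\<Inter>E\<in>C. E n) \<noteq> {}" for n
      using small[of "{}" n] E(2) by auto
    show "y \<in> (\<Inter>E\<in>C. E n) \<longleftrightarrow> inv x \<otimes> y \<in> (\<Inter>E\<in>C. E 0)"
      if x: "x \<in> (\<Inter>E\<in>C. E n)" and y: "y \<in> carrier G" for n x y
    proof -
      have "y \<in> E n \<longleftrightarrow> inv x \<otimes> y \<in> E 0" if "E \<in> C" for E
        using coset_sequence_iff[OF cs[OF that] _ y] x that by blast
      then show ?thesis by simp
    qed
    show "\<forall>\<^sub>F n in sequentially. (\<Inter>E\<in>C. E n) \<subseteq> V"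
      if V: "openin T V" "(\<Inter>E\<in>C. E 0) \<subseteq> V" for V
    proof -
      obtain E where E: "E \<in> C" "E 0 \<subseteq> V" using small[OF V] by blast
      have "\<forall>\<^sub>F n in sequentially. E n \<subseteq> V"
        using coset_sequence_eventually[OF cs[OF E(1)] V(1) E(2)] .
      then show ?thesis by eventually_elim (use E in blast)
    qed
  qed
qed

end

section \<open>Injective sequences converging to the identity\<close>

context profinite_group
begin

text \<open>Zorn's lemma gives a minimal coset sequence \<open>F\<close> below \<open>E\<close>. Any
  \<open>x \<noteq> \<one>\<close> in \<open>F 0\<close> could be removed by refining with an open
  subgroup that omits \<open>x\<close>.\<close>

lemma coset_sequence_lift:
  assumes E: "coset_sequence E"
  shows "\<exists>F. coset_sequence F \<and> F \<le> E \<and> F 0 = {\<one>}"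
proof -
  let ?A = "{F. coset_sequence F \<and> F \<le> E}"
  have "\<exists>M\<in>?A. \<forall>F\<in>?A. F \<le> M \<longrightarrow> F = M"
  \<comment> \<open>The order is reversed, so a maximal element is minimal for pointwise inclusion;
    nonempty chains are bounded by their pointwise intersection.\<close>
  proof (rule predicate_Zorn[where P = "\<lambda>F F'. F' \<le> F"])
    show "partial_order_on ?A (relation_of (\<lambda>F F'. F' \<le> F) ?A)"
      by (rule partial_order_on_relation_ofI) auto
    fix C assume C: "C \<in> Chains (relation_of (\<lambda>F F'. F' \<le> F) ?A)"
    then have CA: "C \<subseteq> ?A" using Chains_relation_of by blast
    have chain: "F \<le> F' \<or> F' \<le> F" if "F \<in> C" "F' \<in> C" for F F'
      using C that unfolding Chains_def relation_of_def by blast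
    show "\<exists>F\<in>?A. \<forall>F'\<in>C. F \<le> F'"
    proof (cases "C = {}")
      case True
      then show ?thesis using E by auto
    next
      case False
      let ?I = "\<lambda>n. \<Inter>F\<in>C. F n"
      have "coset_sequence ?I"
        by (rule coset_sequence_INT_chain[OF compact False]) (use CA chain in auto)
      moreover have lower: "?I \<le> F" if "F \<in> C" for F
        using that by (auto simp: le_fun_def)
      moreover have "?I \<le> E"
      proof -
        obtain F where "F \<in> C" using False by blast
        then show ?thesis using lower[of F] CA by auto
      qed
      ultimately show ?thesis by (intro bexI[of _ ?I]) auto
    qed
  qed
  then obtain F where F: "coset_sequence F" "F \<le> E"
    and F_min: "\<And>F'. coset_sequence F' \<Longrightarrow> F' \<le> E \<Longrightarrow> F' \<le> F \<Longrightarrow> F' = F"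
    by auto
  have minimal: "F' = F" if "coset_sequence F'" "F' \<le> F" for F'
    using F_min[OF that(1) order_trans[OF that(2) F(2)] that(2)] .
  have "x = \<one>" if x: "x \<in> F 0" for x
  proof (rule ccontr)
    assume "x \<noteq> \<one>"
    moreover have "x \<in> carrier G" using x coset_sequence_subset_carrier[OF F(1)] by blast
    ultimately obtain U where U: "subgroup U G" "openin T U" "x \<notin> U"
      using open_subgroup_avoiding by blast
    obtain F' where F': "coset_sequence F'" "F' \<le> F" "F' 0 = F 0 \<inter> U"
      using coset_sequence_refine[OF F(1) U(1,2)] by blast
    then show False using minimal[OF F'(1,2)] x U(3) by blast
  qed
  moreover have "\<one> \<in> F 0" using coset_sequence_one[OF F(1)] .
  ultimately show ?thesis using F by blast
qed

text \<open>Were \<open>U\<close> trivial, its translates would make all points open, and a compact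
  discrete space is finite. So \<open>U\<close> has an element \<open>x \<noteq> \<one>\<close>, and
  intersecting with an open subgroup that omits \<open>x\<close> makes it smaller.\<close>

lemma proper_open_subgroup:
  assumes "infinite (carrier G)" and U: "subgroup U G" "openin T U"
  shows "\<exists>V. subgroup V G \<and> openin T V \<and> V \<subset> U"
proof -
  have "U \<noteq> {\<one>}"
  proof
    assume "U = {\<one>}"
    have "openin T {x}" if "x \<in> carrier G" for x
    proof -
      have "{x} = {y \<in> carrier G. inv x \<otimes> y \<in> U}"
        using that \<open>U = {\<one>}\<close> inv_comm inv_equality by (auto simp: inv_solve_left')
      then show ?thesis using openin_left_translation[of "inv x" U] U that by simp
    qed
    then have "discrete_topology (carrier G) = T"
      by (simp add: discrete_topology_unique topspace_eq_carrier)
    then show False using compact compact_space_discrete_topology assms(1) by metis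
  qed
  then obtain x where x: "x \<in> U" "x \<noteq> \<one>" using subgroup.one_closed[OF U(1)] by blast
  then obtain V where "subgroup V G" "openin T V" "x \<notin> V"
    using open_subgroup_avoiding subgroup.subset[OF U(1)] by blast
  then show ?thesis using x U subgroups_Inter_pair[of U V] openin_Int[of T U V]
    by (intro exI[of _ "U \<inter> V"]) auto
qed

text \<open>The cosets \<open>x n L\<close> lie in the pairwise disjoint sets
  \<open>U n - U (Suc n)\<close>. They converge to \<open>L\<close> because every open set
  containing \<open>L\<close> contains some \<open>U m\<close>.\<close>

lemma exists_disjoint_coset_sequence:
  assumes "infinite (carrier G)"
  shows "\<exists>E. coset_sequence E \<and> (\<forall>m n. m < n \<longrightarrow> E (Suc m) \<inter> E (Suc n) = {})"
proof -
  have "\<exists>U. \<forall>n. (subgroup (U n) G \<and> openin T (U n)) \<and> U (Suc n) \<subset> U n"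
  proof (rule dependent_nat_choice)
    show "\<exists>U. subgroup U G \<and> openin T U"
      using subgroup_self openin_topspace[of T] topspace_eq_carrier by auto
  qed (use proper_open_subgroup[OF assms] in blast)
  then obtain U where "\<forall>n. (subgroup (U n) G \<and> openin T (U n)) \<and> U (Suc n) \<subset> U n" ..
  then have U: "subgroup (U n) G" "openin T (U n)" "U (Suc n) \<subset> U n" for n by simp_all
  have "\<forall>n. \<exists>y. y \<in> U n \<and> y \<notin> U (Suc n)" using U(3) by blast
  then obtain x where x: "\<And>n. x n \<in> U n" "\<And>n. x n \<notin> U (Suc n)" by metis
  have UG: "U n \<subseteq> carrier G" for n using subgroup.subset[OF U(1)] .
  have xG: "x n \<in> carrier G" for n using x UG by blast
  have mono: "U n \<subseteq> U m" if "m \<le> n" for m n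
    using lift_Suc_antimono_le[of U, OF _ that] U(3) by blast
  define L where "L = (\<Inter>n. U n)"
  \<comment> \<open>Index 0 is reserved for \<open>L\<close>, so the coset \<open>x n L\<close> has
    index \<open>Suc n\<close>.\<close>
  define E where "E = case_nat L (\<lambda>n. {y \<in> carrier G. inv (x n) \<otimes> y \<in> L})"
  have L: "subgroup L G" unfolding L_def by (rule subgroups_Inter) (use U in auto)
  have L_closed: "closedin T L"
    unfolding L_def using closedin_open_subgroup[OF U(1,2)] by auto
  have E_sub: "E (Suc n) \<subseteq> U n" for n
    using subgroup_mult_left_iff[OF U(1) subgroup.m_inv_closed[OF U(1) x(1)], of _ n]
    by (auto simp: E_def L_def)
  have E_disj: "E (Suc n) \<inter> U (Suc n) = {}" for n
  proof -
    \<comment> \<open>A common point \<open>y\<close> of \<open>x n U (Suc n)\<close> and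
      \<open>U (Suc n)\<close> would force \<open>x n\<close> into \<open>U (Suc n)\<close>.\<close>
    have False if y: "y \<in> carrier G" "inv (x n) \<otimes> y \<in> U (Suc n)" "y \<in> U (Suc n)" for y
    proof -
      have "y \<otimes> inv (inv (x n) \<otimes> y) \<in> U (Suc n)"
        using y subgroup.m_closed[OF U(1)] subgroup.m_inv_closed[OF U(1)] by blast
      then show False using y xG x(2) by (simp add: inv_mult_group m_assoc[symmetric])
    qed
    then show ?thesis by (auto simp: E_def L_def)
  qed
  have "coset_sequence E"
  proof (rule coset_sequenceI)
    show "\<one> \<in> E 0" using subgroup.one_closed[OF L] by (simp add: E_def)
    show "closedin T (E n)" for n
      using L_closed closedin_left_translation[OF _ L_closed] xG by (cases n) (auto simp: E_def)
    show "E n \<noteq> {}" for n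
      using subgroup.one_closed[OF L] xG by (cases n) (auto simp: E_def intro!: exI[of _ "x (n - 1)"])
  next
    fix n z y assume z: "z \<in> E n" and y: "y \<in> carrier G"
    show "y \<in> E n \<longleftrightarrow> inv z \<otimes> y \<in> E 0"
    proof (cases n)
      case 0
      then show ?thesis
        using z y subgroup_mult_left_iff[OF L subgroup.m_inv_closed[OF L]] by (simp add: E_def)
    next
      case (Suc k)
      have z': "z \<in> carrier G" "inv (x k) \<otimes> z \<in> L" using z Suc by (auto simp: E_def)
      have "inv (x k) \<otimes> y = (inv (x k) \<otimes> z) \<otimes> (inv z \<otimes> y)"
        using z' y xG by (simp add: mult_inv_middle_cancel)
      then show ?thesis using subgroup_mult_left_iff[OF L z'(2), of "inv z \<otimes> y"] z' y Suc by (simp add: E_def)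
    qed
  next
    fix V assume V: "openin T V" "E 0 \<subseteq> V"
    have "\<exists>D\<in>range U. D \<subseteq> V"
    proof (rule compact_space_directed_Inter_subset[OF compact])
      show "\<exists>D\<in>range U. D \<subseteq> A \<inter> B" if AB: "A \<in> range U" "B \<in> range U" for A B
      proof -
        obtain m n where "A = U m" "B = U n" using AB by blast
        then show ?thesis using mono[of m "max m n"] mono[of n "max m n"] by auto
      qed
    qed (use V closedin_open_subgroup[OF U(1,2)] in \<open>auto simp: E_def L_def\<close>)
    then obtain m where m: "U m \<subseteq> V" by blast
    \<comment> \<open>The bound is \<open>Suc m\<close> because \<open>E (Suc k)\<close> lies in
      \<open>U k\<close>.\<close>
    have "E n \<subseteq> V" if n: "n \<ge> Suc m" for n
    proof -
      obtain k where "n = Suc k" "m \<le> k" using n by (cases n) auto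
      then show ?thesis using E_sub[of k] mono[of m k] m by blast
    qed
    then show "\<forall>\<^sub>F n in sequentially. E n \<subseteq> V" unfolding eventually_sequentially by blast
  qed
  \<comment> \<open>For \<open>m < n\<close>, \<open>E (Suc n)\<close> lies in
    \<open>U n \<subseteq> U (Suc m)\<close>, which \<open>E (Suc m)\<close> misses.\<close>
  moreover have "E (Suc m) \<inter> E (Suc n) = {}" if "m < n" for m n
    using E_disj[of m] E_sub[of n] mono[of "Suc m" n] that by auto
  ultimately show ?thesis by blast
qed

text \<open>Once \<open>F 0\<close> is trivial, convergence of the cosets to it is convergence of
  points to \<open>\<one>\<close>; injectivity comes from the disjointness of the larger cosets
  \<open>E (Suc n)\<close>.\<close>

lemma exists_injective_sequence_limitin_one:
  assumes "infinite (carrier G)"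
  shows "\<exists>a. range a \<subseteq> carrier G \<and> inj a \<and> limitin T a \<one> sequentially"
proof -
  obtain E where E: "coset_sequence E" "\<And>m n. m < n \<Longrightarrow> E (Suc m) \<inter> E (Suc n) = {}"
    using exists_disjoint_coset_sequence[OF assms] by blast
  obtain F where F: "coset_sequence F" "F \<le> E" "F 0 = {\<one>}"
    using coset_sequence_lift[OF E(1)] by blast
  \<comment> \<open>Index 0 is skipped, since \<open>F 0\<close> is the limit.\<close>
  have "\<forall>n. \<exists>x. x \<in> F (Suc n)" using coset_sequence_nonempty[OF F(1)] by blast
  then obtain a where a: "\<And>n. a n \<in> F (Suc n)" by metis
  have aE: "a n \<in> E (Suc n)" for n using a[of n] le_funD[OF F(2)] by blast
  have "a m \<noteq> a n" if "m < n" for m n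
    using E(2)[OF that] aE[of m] aE[of n] by auto
  then have "inj a" by (metis injI linorder_neqE_nat)
  moreover have "range a \<subseteq> carrier G" using a coset_sequence_subset_carrier[OF F(1)] by blast
  moreover have "limitin T a \<one> sequentially"
    unfolding limitin_def
  proof (intro conjI allI impI)
    show "\<one> \<in> topspace T" using topspace_eq_carrier by simp
    fix V assume V: "openin T V \<and> \<one> \<in> V"
    then have "\<forall>\<^sub>F n in sequentially. F n \<subseteq> V"
      using coset_sequence_eventually[OF F(1)] F(3) by simp
    then have "\<forall>\<^sub>F n in sequentially. F (Suc n) \<subseteq> V"
      by (rule eventually_sequentially_Suc[THEN iffD2])
    then show "\<forall>\<^sub>F n in sequentially. a n \<in> V" by eventually_elim (use a in blast)
  qed
  ultimately show ?thesis by blast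
qed

end

section \<open>Reduction to the closure of a countable subgroup\<close>

theorem corollary7p2:
  fixes G :: "('a, 'b) monoid_scheme" and T :: "'a topology"
  assumes "topological_group G T"
    and "infinite (carrier G)"
    and "totally_disconnected_space T"
    and "omega_bounded T"
  shows "\<exists>a :: nat \<Rightarrow> 'a. unconditionally_f_omega_productive G T a"
proof -
  interpret topological_group G T by fact
  \<comment> \<open>Countability will make the closure of a subgroup containing \<open>S\<close>
    compact; infinitude of \<open>S\<close> keeps that closure infinite.\<close>
  obtain S where S: "S \<subseteq> carrier G" "infinite S" "countable S"
    using infinite_countable_subset'[OF assms(2)] by blast
  then obtain H where H: "subgroup H G" "S \<subseteq> H" "countable H"
    using countable_subgroup_superset by blast
  define K where "K = T closure_of H"
  have HT: "H \<subseteq> topspace T" using subgroup.subset[OF H(1)] topspace_eq_carrier by simp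
  have K: "subgroup K G" unfolding K_def by (rule subgroup_closure_of[OF H(1)])
  have "compactin T K"
    using assms(4) HT H(3) unfolding omega_bounded_def K_def by blast
  then interpret K: profinite_group "G\<lparr>carrier := K\<rparr>" "subtopology T K"
    using topological_group_subgroup[OF K] totally_disconnected_space_subtopology[OF assms(3)]
    by (intro profinite_group.intro profinite_group_axioms.intro) (auto simp: compact_space_subtopology)
  have "infinite K"
    using S(2) H(2) closure_of_subset[OF HT] unfolding K_def by (metis finite_subset)
  then obtain a where "range a \<subseteq> K" "inj a" "limitin (subtopology T K) a \<one>\<^bsub>G\<lparr>carrier := K\<rparr>\<^esub> sequentially"
    using K.exists_injective_sequence_limitin_one by auto
  then have "unconditionally_f_omega_productive (G\<lparr>carrier := K\<rparr>) (subtopology T K) a"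
    by (intro K.unconditionally_f_omega_productive_of_limitin_one) auto
  then show ?thesis using unconditionally_f_omega_productive_of_subgroup[OF K] by blast
qed

end
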